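(* Let $-\infty\le l<u\le\infty$ be independent of the parameter vector $\lambda$, and let $$q(z\mid\lambda)=h_z(z)\exp\{\langle T_z(z),\phi_z(\lambda)\rangle-A_z(\lambda)\},\qquad z\in(l,u),$$ be an exponential-family probability density on $(l,u)$, positive there, locally AC with respect to $z$ and differentiable with respect to $\lambda$. Let $\psi(z,\lambda)=\int_l^zq(t\mid\lambda)\,dt$ be its CDF. Let $h:(l,u)\to\mathbb{R}$ be locally AC, let $\lambda_i$ be a scalar component of $\lambda$, and define $$f_i(z):=\frac{\nabla_{\lambda_i}\psi(z,\lambda)}{q(z\mid\lambda)},\qquad \tilde f_i(z):=h(z)f_i(z).$$ Assume that $\tilde f_i$ is locally AC on $(l,u)$, that $\lim_{z\downarrow l}\tilde f_i(z)q(z\mid\lambda)=0$ and $\lim_{z\uparrow u}\tilde f_i(z)q(z\mid\lambda)=0$, and that the expectations $\mathbb{E}_q[\nabla_z\tilde f_i(z)]$, $\mathbb{E}_q\big[\tilde f_i(z)\frac{\nabla_zq(z\mid\lambda)}{q(z\mid\lambda)}\big]$, $\mathbb{E}_q[h(z)]$, $\mathbb{E}_q\big[h(z)\frac{\nabla_{\lambda_i}q(z\mid\lambda)}{q(z\mid\lambda)}\big]$ and $\mathbb{E}_q[f_i(z)\nabla_zh(z)]$ are well-defined. Assume also that differentiation and integration may be interchanged: $\nabla_{\lambda_i}\mathbb{E}_q[h(z)]=\mathbb{E}_q\big[h(z)\frac{\nabla_{\lambda_i}q(z\mid\lambda)}{q(z\mid\lambda)}\big]$ and $\nabla_{\lambda_i}\psi(z,\lambda)=\int_l^z\nabla_{\lambda_i}q(t\mid\lambda)\,dt$.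 Then $$\nabla_{\lambda_i}\mathbb{E}_q[h(z)]=-\mathbb{E}_q[f_i(z)\,\nabla_zh(z)].$$
   Context: $\mathbb{E}_q$ is expectation under $q(z\mid\lambda)$. An expectation $\mathbb{E}_q[g]$ is called well-defined if $\mathbb{E}_q[|g|]<\infty$. A function $g:[a,b]\to\mathbb{R}$ is absolutely continuous (AC) if its derivative exists almost everywhere on $[a,b]$, is Lebesgue integrable, and $g(x)=g(a)+\int_a^x g'(t)\,dt$ for all $x\in[a,b]$. A function on $(l,u)$ is locally AC if it is AC on every compact interval inside $(l,u)$; $\nabla_z$ denotes its almost-everywhere derivative. *)

theory Defs
  imports "HOL-Probability.Probability"
begin

definition AC_on :: "real \<Rightarrow> real \<Rightarrow> (real \<Rightarrow> real) \<Rightarrow> bool" where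
  "AC_on a b g \<longleftrightarrow>
     (AE x in lebesgue. x \<in> {a..b} \<longrightarrow> g differentiable (at x)) \<and>
     set_integrable lebesgue {a..b} (deriv g) \<and>
     (\<forall>x\<in>{a..b}. g x = g a + (LINT t:{a..x}|lebesgue. deriv g t))"

(* The two-sided derivative at the end points a and b depends on values of g
   outside the interval, but the end points form a null set. *)

definition locally_AC_on :: "real set \<Rightarrow> (real \<Rightarrow> real) \<Rightarrow> bool" where
  "locally_AC_on S g \<longleftrightarrow> (\<forall>a b. a \<le> b \<and> {a..b} \<subseteq> S \<longrightarrow> AC_on a b g)"

definition has_partial_derivative ::
    "(real ^ 'n \<Rightarrow> real) \<Rightarrow> real \<Rightarrow> 'n \<Rightarrow> real ^ 'n \<Rightarrow> bool" where
  "has_partial_derivative F D i x \<longleftrightarrow>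
     ((\<lambda>s. F (x + s *\<^sub>R axis i 1)) has_real_derivative D) (at 0)"

definition partial_deriv :: "'n \<Rightarrow> (real ^ 'n \<Rightarrow> real) \<Rightarrow> real ^ 'n \<Rightarrow> real" where
  "partial_deriv i F x = deriv (\<lambda>s. F (x + s *\<^sub>R axis i 1)) 0"

(* The measure with Lebesgue density p on the open interval (l, u). Its space is
   the interval itself, so measurability and integrability of a function do not
   depend on its values outside (l, u). *)

definition interval_distr :: "ereal \<Rightarrow> ereal \<Rightarrow> (real \<Rightarrow> real) \<Rightarrow> real measure" where
  "interval_distr l u p =
     density (restrict_space lborel (einterval l u)) (\<lambda>z. ennreal (p z))"

definition interval_cdf :: "ereal \<Rightarrow> (real \<Rightarrow> real) \<Rightarrow> real \<Rightarrow> real" where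
  "interval_cdf l p z = (LBINT t=l..ereal z. p t)"

end

theory Submission
  imports Defs
begin

text \<open>
  The function $G = f q$ is the $\lambda_i$-derivative of the CDF, hence the indefinite integral
  of $r = \nabla_{\lambda_i} q$. Integration by parts on compact subintervals, together with the
  vanishing of $h G$ at both ends, gives $\int h r = - \int h' G$; these two integrals are
  $E_q[h\, r / q]$ and $E_q[f h']$.
\<close>

section \<open>Fubini on a triangle and integration by parts for indefinite integrals\<close>

lemma sigma_finite_lebesgue: "sigma_finite_measure (lebesgue :: 'a::euclidean_space measure)"
proof
  obtain C :: "'a set set" where C: "countable C" "C \<subseteq> sets lborel" "\<Union>C = space lborel"
      "\<forall>a\<in>C. emeasure lborel a \<noteq> \<infinity>"
    using lborel.sigma_finite_countable by blast
  then show "\<exists>C :: 'a set set. countable C \<and> C \<subseteq> sets lebesgue \<and> \<Union>C = space lebesgue \<and>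
      (\<forall>a\<in>C. emeasure lebesgue a \<noteq> \<infinity>)"
    \<comment> \<open>The Borel cover still works for the completion, because both measures agree on
      Borel sets.\<close>
    by (intro exI[of _ C]) auto
qed

text \<open>The function \<open>k s * m t\<close> is integrable on the square over
  \<open>{a..b}\<close>. Cutting the square along its diagonal and integrating each triangle in the
  suitable order turns the two halves into the two iterated integrals, so they are integrable and
  add up to the integral over the square, which factors.\<close>

lemma set_integrable_lebesgue_Fubini_triangle:
  fixes k m :: "real \<Rightarrow> real"
  assumes k: "set_integrable lebesgue {a..b} k" and m: "set_integrable lebesgue {a..b} m"
  shows "set_integrable lebesgue {a..b} (\<lambda>s. k s * (LINT t:{a..s}|lebesgue. m t))"
    and "set_integrable lebesgue {a..b} (\<lambda>t. m t * (LINT s:{a..t}|lebesgue. k s))"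
    and "(LINT s:{a..b}|lebesgue. k s * (LINT t:{a..s}|lebesgue. m t)) +
         (LINT t:{a..b}|lebesgue. m t * (LINT s:{a..t}|lebesgue. k s)) =
         (LINT s:{a..b}|lebesgue. k s) * (LINT t:{a..b}|lebesgue. m t)"
proof -
  interpret sigma_finite_measure "lebesgue :: real measure"
    by (rule sigma_finite_lebesgue)
  interpret L: pair_sigma_finite "lebesgue :: real measure" "lebesgue :: real measure" ..
  let ?L = "lebesgue \<Otimes>\<^sub>M lebesgue :: (real \<times> real) measure"
  define k' m' where "k' = (\<lambda>s. indicator {a..b} s * k s)"
    and "m' = (\<lambda>s. indicator {a..b} s * m s)"
  define D where "D = {p :: real \<times> real. snd p \<le> fst p}"
  have k': "integrable lebesgue k'" and m': "integrable lebesgue m'"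
    using k m by (simp_all add: set_integrable_def k'_def m'_def)
  have P: "integrable ?L (\<lambda>(s, t). k' s * m' t)"
  proof (rule L.Fubini_integrable)
    have [measurable]: "k' \<in> borel_measurable lebesgue" "m' \<in> borel_measurable lebesgue"
      using k' m' by auto
    show "(\<lambda>(s, t). k' s * m' t) \<in> borel_measurable ?L"
      by measurable
    show "integrable lebesgue (\<lambda>s. LINT t|lebesgue. norm (case (s, t) of (s, t) \<Rightarrow> k' s * m' t))"
      using k' by (simp add: abs_mult)
    show "AE s in lebesgue. integrable lebesgue (\<lambda>t. case (s, t) of (s, t) \<Rightarrow> k' s * m' t)"
      using m' by simp
  qed
  \<comment> \<open>The projections of \<open>?L\<close> are measurable into
    \<open>lebesgue\<close>. Composing with the identity makes them Borel functions, so the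
    half-plane \<open>D\<close> is measurable by comparing them.\<close>
  have id: "(\<lambda>x. x) \<in> borel_measurable (lebesgue :: real measure)"
    by (rule measurable_completion) simp
  have [measurable]: "fst \<in> borel_measurable ?L" "snd \<in> borel_measurable ?L"
    using measurable_compose[OF measurable_fst id] measurable_compose[OF measurable_snd id]
    by auto
  have "{p \<in> space ?L. snd p \<le> fst p} \<in> sets ?L"
    by measurable
  then have D: "D \<in> sets ?L"
    by (simp add: D_def space_pair_measure)
  define P1 P2 where "P1 s t = indicator D (s, t) * (k' s * m' t)"
    and "P2 s t = indicator (- D) (s, t) * (k' s * m' t)" for s t
  have iP1: "integrable ?L (case_prod P1)"
    using integrable_mult_indicator[OF D P] by (simp add: P1_def split_def)
  have "- D \<in> sets ?L"
    using sets.compl_sets[OF D] by (simp add: space_pair_measure Compl_eq_Diff_UNIV)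
  then have iP2: "integrable ?L (case_prod P2)"
    using integrable_mult_indicator[OF _ P, of "- D"] by (simp add: P2_def split_def)
  \<comment> \<open>For \<open>s\<close> in \<open>{a..b}\<close> the section of \<open>D\<close>
    cuts \<open>{a..b}\<close> down to exactly \<open>{a..s}\<close>, so the integrands agree
    pointwise.\<close>
  have in1: "(LINT t|lebesgue. P1 s t) =
      indicator {a..b} s * (k s * (LINT t:{a..s}|lebesgue. m t))" for s
  proof -
    have "P1 s t = (indicator {a..b} s * k s) * (indicator {a..s} t *\<^sub>R m t)" for t
      by (auto simp: P1_def D_def k'_def m'_def indicator_def)
    then show ?thesis
      by (simp add: set_lebesgue_integral_def mult.assoc)
  qed
  have in2: "(LINT s|lebesgue. P2 s t) =
      indicator {a..b} t * (m t * (LINT s:{a..t}|lebesgue. k s))" for t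
  proof -
    \<comment> \<open>The section of \<open>- D\<close> is the strict inequality
      \<open>s < t\<close>, which gives a half-open interval. It differs from \<open>{a..t}\<close>
      only in the null set containing \<open>t\<close>, hence equality almost everywhere.\<close>
    have "(LINT s|lebesgue. P2 s t) =
        (LINT s|lebesgue. (indicator {a..b} t * m t) * (indicator {a..t} s *\<^sub>R k s))"
    proof (rule integral_cong_AE)
      \<comment> \<open>Nothing is known about \<open>k\<close> beyond \<open>b\<close>, but for
        \<open>t > b\<close> the factor \<open>indicator {a..b} t\<close> makes the function
        zero.\<close>
      have "set_integrable lebesgue {a..t} k" if "t \<le> b"
        using k by (rule set_integrable_subset) (use that in auto)
      then show "(\<lambda>s. (indicator {a..b} t * m t) * (indicator {a..t} s *\<^sub>R k s))
          \<in> borel_measurable lebesgue"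
        by (cases "t \<le> b") (auto simp: set_integrable_def indicator_def)
      have "(\<lambda>s. (s, t)) \<in> measurable lebesgue ?L"
        by measurable
      from measurable_compose[OF this borel_measurable_integrable[OF iP2]]
      show "(\<lambda>s. P2 s t) \<in> borel_measurable lebesgue"
        by simp
      have "AE s in lebesgue. s \<noteq> t"
        by (intro AE_completion AE_lborel_singleton)
      then show "AE s in lebesgue. P2 s t =
          (indicator {a..b} t * m t) * (indicator {a..t} s *\<^sub>R k s)"
        by eventually_elim (auto simp: P2_def D_def k'_def m'_def indicator_def)
    qed
    then show ?thesis
      by (simp add: set_lebesgue_integral_def mult.assoc)
  qed
  show "set_integrable lebesgue {a..b} (\<lambda>s. k s * (LINT t:{a..s}|lebesgue. m t))"
    using L.integrable_fst[OF iP1] by (simp add: in1 set_integrable_def)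
  show "set_integrable lebesgue {a..b} (\<lambda>t. m t * (LINT s:{a..t}|lebesgue. k s))"
    using L.integrable_snd[OF iP2] by (simp add: in2 set_integrable_def)
  have "(LINT s:{a..b}|lebesgue. k s * (LINT t:{a..s}|lebesgue. m t)) +
         (LINT t:{a..b}|lebesgue. m t * (LINT s:{a..t}|lebesgue. k s)) =
        integral\<^sup>L ?L (case_prod P1) + integral\<^sup>L ?L (case_prod P2)"
    using L.integral_fst[OF iP1] L.integral_snd[OF iP2]
    by (simp add: in1 in2 set_lebesgue_integral_def)
  also have "\<dots> = integral\<^sup>L ?L (\<lambda>p. case_prod P1 p + case_prod P2 p)"
    using iP1 iP2 by simp
  also have "(\<lambda>p. case_prod P1 p + case_prod P2 p) = (\<lambda>(s, t). k' s * m' t)"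
    by (auto simp: P1_def P2_def indicator_def)
  also have "integral\<^sup>L ?L (\<lambda>(s, t). k' s * m' t) = (LINT s|lebesgue. LINT t|lebesgue. k' s * m' t)"
    using L.integral_fst[OF P] by simp
  also have "\<dots> = (LINT s:{a..b}|lebesgue. k s) * (LINT t:{a..b}|lebesgue. m t)"
    by (simp add: set_lebesgue_integral_def k'_def m'_def)
  finally show "(LINT s:{a..b}|lebesgue. k s * (LINT t:{a..s}|lebesgue. m t)) +
         (LINT t:{a..b}|lebesgue. m t * (LINT s:{a..t}|lebesgue. k s)) =
         (LINT s:{a..b}|lebesgue. k s) * (LINT t:{a..b}|lebesgue. m t)" .
qed

text \<open>Split \<open>F\<close> and \<open>G\<close> into their values at \<open>a\<close> plus
  indefinite integrals. The constants contribute linear terms and the rest is the triangle identity.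
  The hypotheses speak of indefinite integrals and not of derivatives because \<open>G'\<close> will
  be the parameter derivative of the density, given only as an integrand.\<close>

lemma lebesgue_integral_by_parts_indefinite:
  fixes F G F' G' :: "real \<Rightarrow> real"
  assumes "a \<le> b"
    and F': "set_integrable lebesgue {a..b} F'" and G': "set_integrable lebesgue {a..b} G'"
    and F: "\<And>x. x \<in> {a..b} \<Longrightarrow> F x = F a + (LINT t:{a..x}|lebesgue. F' t)"
    and G: "\<And>x. x \<in> {a..b} \<Longrightarrow> G x = G a + (LINT t:{a..x}|lebesgue. G' t)"
  shows "(LINT x:{a..b}|lebesgue. F' x * G x + F x * G' x) = F b * G b - F a * G a"
proof -
  note tri = set_integrable_lebesgue_Fubini_triangle[OF F' G']
  let ?I = "\<lambda>x. LINT t:{a..x}|lebesgue. F' t" and ?J = "\<lambda>x. LINT t:{a..x}|lebesgue. G' t"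
  have "(LINT x:{a..b}|lebesgue. F' x * G x + F x * G' x) =
      (LINT x:{a..b}|lebesgue. (G a * F' x + F a * G' x) + (F' x * ?J x + G' x * ?I x))"
  proof (intro set_lebesgue_integral_cong allI impI)
    fix x assume x: "x \<in> {a..b}"
    show "F' x * G x + F x * G' x = (G a * F' x + F a * G' x) + (F' x * ?J x + G' x * ?I x)"
      unfolding F[OF x] G[OF x] by (simp add: algebra_simps)
  qed simp
  also have "\<dots> = (G a * ?I b + F a * ?J b) + ?I b * ?J b"
    using F' G' tri by simp
  also have "\<dots> = F b * G b - F a * G a"
    using F[of b] G[of b] \<open>a \<le> b\<close> by (simp add: algebra_simps)
  finally show ?thesis .
qed

section \<open>Continuity of absolutely continuous functions\<close>

lemma AC_on_imp_continuous_on: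
  assumes "AC_on a b g"
  shows "continuous_on {a..b} g"
proof -
  have int: "set_integrable lebesgue {a..b} (deriv g)"
    and eq: "\<And>x. x \<in> {a..b} \<Longrightarrow> g x = g a + (LINT t:{a..x}|lebesgue. deriv g t)"
    using assms unfolding AC_on_def by blast+
  \<comment> \<open>Continuity is known for the indefinite gauge integral \<open>integral\<close>,
    which agrees with the Lebesgue integral for Lebesgue integrable functions.\<close>
  have "continuous_on {a..b} (\<lambda>x. g a + integral {a..x} (deriv g))"
    using set_lebesgue_integral_eq_integral(1)[OF int]
    by (intro continuous_intros indefinite_integral_continuous_1)
  moreover have "g a + integral {a..x} (deriv g) = g x" if "x \<in> {a..b}" for x
  proof -
    have "set_integrable lebesgue {a..x} (deriv g)"
      using int by (rule set_integrable_subset) (use that in auto)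
    then show ?thesis
      using eq[OF that] by (simp only: set_lebesgue_integral_eq_integral(2))
  qed
  ultimately show ?thesis
    by (rule continuous_on_eq)
qed

text \<open>A closed ball around a point of \<open>S\<close> is a compact interval on which the
  previous lemma applies. The continuity of \<open>q lam\<close> obtained this way supplies its
  measurability as a density.\<close>

lemma locally_AC_on_imp_continuous_on:
  assumes "open S" and "locally_AC_on S g"
  shows "continuous_on S g"
proof -
  have "isCont g x" if "x \<in> S" for x
  proof -
    obtain e where e: "e > 0" "cball x e \<subseteq> S"
      using \<open>open S\<close> \<open>x \<in> S\<close> open_contains_cball by blast
    then have "AC_on (x - e) (x + e) g"
      using assms(2) by (auto simp: locally_AC_on_def cball_eq_atLeastAtMost)
    then have "continuous_on {x - e<..<x + e} g"
      by (intro continuous_on_subset[OF AC_on_imp_continuous_on]) auto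
    then show ?thesis
      using e(1) by (simp add: continuous_on_eq_continuous_at)
  qed
  then show ?thesis
    by (simp add: continuous_at_imp_continuous_on)
qed

section \<open>Expectations under \<open>interval_distr\<close> as weighted Lebesgue
  integrals\<close>

context
  fixes l u :: ereal and p :: "real \<Rightarrow> real"
  assumes cont: "continuous_on (einterval l u) p"
    and nonneg: "\<And>z. z \<in> einterval l u \<Longrightarrow> 0 \<le> p z"
begin

lemma interval_distr_density_measurable:
  "p \<in> borel_measurable (restrict_space lborel (einterval l u))"
  using borel_measurable_continuous_on_restrict[OF cont]
  by (simp cong: measurable_cong_sets add: sets_restrict_space)

lemma interval_distr_density_AE:
  "AE z in restrict_space lborel (einterval l u). 0 \<le> p z"
  by (rule AE_I2) (use nonneg in \<open>simp add: space_restrict_space\<close>)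

lemma integrable_interval_distr:
  fixes g :: "real \<Rightarrow> real"
  assumes "integrable (interval_distr l u p) g"
  shows "set_integrable lborel (einterval l u) (\<lambda>z. p z * g z)"
proof -
  \<comment> \<open>A density keeps the sigma-algebra, so the measurability contained in
    integrability passes back to the restricted Lebesgue measure.\<close>
  have "g \<in> borel_measurable (restrict_space lborel (einterval l u))"
    using borel_measurable_integrable[OF assms] by (simp add: interval_distr_def)
  then show ?thesis
    using assms interval_distr_density_measurable interval_distr_density_AE
    by (simp add: interval_distr_def integrable_density integrable_restrict_space set_integrable_def)
qed

lemma integral_interval_distr:
  fixes g :: "real \<Rightarrow> real"
  assumes "integrable (interval_distr l u p) g"
  shows "(LINT z|interval_distr l u p. g z) = (LINT z:einterval l u|lborel. p z * g z)"
proof -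
  have "g \<in> borel_measurable (restrict_space lborel (einterval l u))"
    using borel_measurable_integrable[OF assms] by (simp add: interval_distr_def)
  then show ?thesis
    using interval_distr_density_measurable interval_distr_density_AE
    by (simp add: interval_distr_def integral_density integral_restrict_space
        set_lebesgue_integral_def)
qed

end

section \<open>Derivative of the CDF as an indefinite integral\<close>

lemma has_partial_derivative_imp_partial_deriv:
  "has_partial_derivative F D i x \<Longrightarrow> partial_deriv i F x = D"
  unfolding has_partial_derivative_def partial_deriv_def by (rule DERIV_imp_deriv)

text \<open>Additivity of the integral at \<open>a\<close>. It passes from an integral starting at
  the possibly infinite end \<open>l\<close> to the compact form that integration by parts expects,
  and from \<open>lborel\<close> to \<open>lebesgue\<close>.\<close>

lemma lebesgue_integral_Icc_diff:
  fixes r :: "real \<Rightarrow> real"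
  assumes "l < ereal a" "a \<le> x"
    and r: "interval_lebesgue_integrable lborel l (ereal x) r"
  shows "set_integrable lebesgue {a..x} r"
    and "(LBINT t=l..ereal x. r t) = (LBINT t=l..ereal a. r t) + (LINT t:{a..x}|lebesgue. r t)"
proof -
  have lx: "l < ereal x"
    using assms less_le_trans by fastforce
  then have "set_integrable lborel (einterval l (ereal x)) r"
    using r by (simp add: interval_lebesgue_integrable_def)
  then have "set_integrable lborel {a..<x} r"
    by (rule set_integrable_subset)
      (use assms in \<open>auto simp: einterval_def intro: less_le_trans\<close>)
  \<comment> \<open>The open interval ending at \<open>x\<close> misses \<open>x\<close> itself;
    adding one point changes nothing.\<close>
  then have ax: "set_integrable lborel {a..x} r"
    by (rule set_integrable_discrete_difference[THEN iffD1, of "{x}", rotated -1]) auto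
  have meas: "(\<lambda>t. indicator {a..x} t *\<^sub>R r t) \<in> borel_measurable lborel"
    using ax by (auto simp: set_integrable_def)
  show "set_integrable lebesgue {a..x} r"
    using ax meas by (simp add: set_integrable_def integrable_completion)
  have "(LINT t:{a..x}|lebesgue. r t) = (LBINT t=a..x. r t)"
    using meas \<open>a \<le> x\<close>
    by (simp add: interval_integral_Icc set_lebesgue_integral_def integral_completion)
  moreover have "(LBINT t=l..a. r t) + (LBINT t=a..x. r t) = (LBINT t=l..x. r t)"
    using assms lx by (intro interval_integral_sum) (auto simp: min_def max_def)
  ultimately show "(LBINT t=l..ereal x. r t) =
      (LBINT t=l..ereal a. r t) + (LINT t:{a..x}|lebesgue. r t)"
    by simp
qed

section \<open>The gradient identity\<close>

theorem theorem5:
  fixes l u :: ereal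
    and \<Lambda> :: "(real ^ 'n) set"
    and lam :: "real ^ 'n"
    and i :: 'n
    and q :: "real ^ 'n \<Rightarrow> real \<Rightarrow> real"
    and hz :: "real \<Rightarrow> real"
    and T :: "real \<Rightarrow> 'k::euclidean_space"
    and \<phi> :: "real ^ 'n \<Rightarrow> 'k"
    and A :: "real ^ 'n \<Rightarrow> real"
    and h f :: "real \<Rightarrow> real"
  assumes "l < u"
    and "open \<Lambda>" and "lam \<in> \<Lambda>"
    and exp_family: "\<And>\<mu> z. \<mu> \<in> \<Lambda> \<Longrightarrow> z \<in> einterval l u \<Longrightarrow>
          q \<mu> z = hz z * exp (T z \<bullet> \<phi> \<mu> - A \<mu>)"
    and q_pos: "\<And>\<mu> z. \<mu> \<in> \<Lambda> \<Longrightarrow> z \<in> einterval l u \<Longrightarrow> q \<mu> z > 0"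
    and q_density: "\<And>\<mu>. \<mu> \<in> \<Lambda> \<Longrightarrow> prob_space (interval_distr l u (q \<mu>))"
    and q_AC: "\<And>\<mu>. \<mu> \<in> \<Lambda> \<Longrightarrow> locally_AC_on (einterval l u) (q \<mu>)"
    and q_diff: "\<And>\<mu> z. \<mu> \<in> \<Lambda> \<Longrightarrow> z \<in> einterval l u \<Longrightarrow>
          (\<lambda>\<nu>. q \<nu> z) differentiable (at \<mu>)"
    and h_AC: "locally_AC_on (einterval l u) h"
    and f_def: "\<And>z. z \<in> einterval l u \<Longrightarrow>
          f z = partial_deriv i (\<lambda>\<mu>. interval_cdf l (q \<mu>) z) lam / q lam z"
    and hf_AC: "locally_AC_on (einterval l u) (\<lambda>z. h z * f z)"
    and lim_l: "(((\<lambda>z. (h z * f z) * q lam z) \<circ> real_of_ereal) \<longlongrightarrow> 0) (at_right l)"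
    and lim_u: "(((\<lambda>z. (h z * f z) * q lam z) \<circ> real_of_ereal) \<longlongrightarrow> 0) (at_left u)"
    and "integrable (interval_distr l u (q lam)) (\<lambda>z. deriv (\<lambda>y. h y * f y) z)"
    and "integrable (interval_distr l u (q lam))
          (\<lambda>z. (h z * f z) * (deriv (q lam) z / q lam z))"
    and "integrable (interval_distr l u (q lam)) h"
    and "integrable (interval_distr l u (q lam))
          (\<lambda>z. h z * (partial_deriv i (\<lambda>\<mu>. q \<mu> z) lam / q lam z))"
    and "integrable (interval_distr l u (q lam)) (\<lambda>z. f z * deriv h z)"
    and interchange_expectation:
      "has_partial_derivative (\<lambda>\<mu>. LINT z|interval_distr l u (q \<mu>). h z)
         (LINT z|interval_distr l u (q lam).
            h z * (partial_deriv i (\<lambda>\<mu>. q \<mu> z) lam / q lam z)) i lam"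
    and dq_integrable: "\<And>z. z \<in> einterval l u \<Longrightarrow>
          interval_lebesgue_integrable lborel l (ereal z)
            (\<lambda>t. partial_deriv i (\<lambda>\<mu>. q \<mu> t) lam)"
    and interchange_cdf: "\<And>z. z \<in> einterval l u \<Longrightarrow>
          has_partial_derivative (\<lambda>\<mu>. interval_cdf l (q \<mu>) z)
            (LBINT t=l..ereal z. partial_deriv i (\<lambda>\<mu>. q \<mu> t) lam) i lam"
  shows "has_partial_derivative (\<lambda>\<mu>. LINT z|interval_distr l u (q \<mu>). h z)
           (- (LINT z|interval_distr l u (q lam). f z * deriv h z)) i lam"
proof -
  let ?E = "einterval l u"
  define r where "r = (\<lambda>t. partial_deriv i (\<lambda>\<mu>. q \<mu> t) lam)"
  define G where "G = (\<lambda>z. LBINT t=l..ereal z. r t)"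
  \<comment> \<open>\<open>X\<close> is the product rule applied to \<open>h * G\<close>, so its
    integrals over compact intervals are boundary terms.\<close>
  define X where "X = (\<lambda>z. deriv h z * G z + h z * r z)"
  have pos: "q lam z > 0" if "z \<in> ?E" for z
    using q_pos \<open>lam \<in> \<Lambda>\<close> that by blast
  have cont: "continuous_on ?E (q lam)"
    using q_AC[OF \<open>lam \<in> \<Lambda>\<close>] by (intro locally_AC_on_imp_continuous_on) auto
  have fq: "f z * q lam z = G z" if "z \<in> ?E" for z
    using f_def[OF that] has_partial_derivative_imp_partial_deriv[OF interchange_cdf[OF that]]
      pos[OF that] by (simp add: G_def r_def)
  have hfq: "h z * f z * q lam z = h z * G z" if "z \<in> ?E" for z
    using fq[OF that] by (simp add: mult.assoc)
  have nonneg: "\<And>z. z \<in> ?E \<Longrightarrow> 0 \<le> q lam z"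
    using pos by (rule less_imp_le)
  have distr_integrable: "set_integrable lborel ?E (\<lambda>z. q lam z * g z)"
    and distr_integral: "(LINT z|interval_distr l u (q lam). g z) =
      (LINT z:?E|lborel. q lam z * g z)"
    if "integrable (interval_distr l u (q lam)) g" for g
    using integrable_interval_distr[OF cont nonneg that]
      integral_interval_distr[OF cont nonneg that] by auto
  let ?U = "\<lambda>z. f z * deriv h z" and ?V = "\<lambda>z. h z * (r z / q lam z)"
  have U: "integrable (interval_distr l u (q lam)) ?U"
    and V: "integrable (interval_distr l u (q lam)) ?V"
    using assms unfolding r_def by blast+
  \<comment> \<open>Here \<open>f z * q lam z\<close> becomes \<open>G z\<close> in the first
    summand, and \<open>q lam z\<close> cancels in the second.\<close>
  have X: "q lam z * ?U z + q lam z * ?V z = X z" if "z \<in> ?E" for z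
    using fq[OF that, symmetric] pos[OF that] by (simp add: X_def)
  \<comment> \<open>Integrability on all of \<open>?E\<close> comes from the two assumed
    expectations. It later justifies the passage from compact intervals to
    \<open>?E\<close>.\<close>
  have X_int: "set_integrable lborel ?E X"
    using set_integral_add(1)[OF distr_integrable[OF U] distr_integrable[OF V]]
    by (rule set_integrable_cong[THEN iffD1, rotated -1]) (use X in auto)
  have "(LINT z:?E|lborel. X z) =
      (LINT z:?E|lborel. q lam z * ?U z + q lam z * ?V z)"
    by (rule set_lebesgue_integral_cong) (use X in auto)
  also have "\<dots> = (LINT z|interval_distr l u (q lam). ?U z)
      + (LINT z|interval_distr l u (q lam). ?V z)"
    using set_integral_add(2)[OF distr_integrable[OF U] distr_integrable[OF V]]
    by (simp only: distr_integral[OF U] distr_integral[OF V])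
  finally have X_integral: "(LINT z:?E|lborel. X z) = (LINT z|interval_distr l u (q lam). ?U z)
      + (LINT z|interval_distr l u (q lam). ?V z)" .

  have parts: "(LBINT z=ereal a..ereal b. X z) = h b * G b - h a * G a"
    if ab: "a < b" "l < ereal a" "ereal b < u" for a b
  proof -
    have sub: "{a..b} \<subseteq> ?E"
    proof
      fix z assume "z \<in> {a..b}"
      then have "l < ereal z" "ereal z < u"
        using ab less_le_trans[of l "ereal a" "ereal z"] le_less_trans[of "ereal z" "ereal b" u]
        by auto
      then show "z \<in> ?E" by (simp add: einterval_def)
    qed
    then have hab: "AC_on a b h"
      using h_AC ab unfolding locally_AC_on_def by auto
    have rz: "interval_lebesgue_integrable lborel l (ereal z) r" if "z \<in> {a..b}" for z
      using dq_integrable[of z] sub that unfolding r_def by blast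
    have "(LINT x:{a..b}|lebesgue. deriv h x * G x + h x * r x) = h b * G b - h a * G a"
    proof (rule lebesgue_integral_by_parts_indefinite)
      show "set_integrable lebesgue {a..b} r"
        using lebesgue_integral_Icc_diff(1)[of l a b r] rz[of b] ab by simp
      show "G x = G a + (LINT t:{a..x}|lebesgue. r t)" if "x \<in> {a..b}" for x
        using lebesgue_integral_Icc_diff(2)[of l a x r] rz[of x] ab that
        unfolding G_def by simp
    qed (use hab ab less_imp_le in \<open>unfold AC_on_def, blast+\<close>)
    \<comment> \<open>This provides the Borel measurability with which the \<open>lebesgue\<close>
      integral is rewritten as one over \<open>lborel\<close>.\<close>
    moreover have "set_integrable lborel {a..b} X"
      using X_int by (rule set_integrable_subset) (use sub in auto)
    ultimately show ?thesis
      using ab by (auto simp: X_def interval_integral_Icc set_lebesgue_integral_def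
          set_integrable_def integral_completion dest: borel_measurable_integrable)
  qed

  \<comment> \<open>An exhaustion by compact intervals treats finite and infinite ends
    alike.\<close>
  obtain b a :: "nat \<Rightarrow> real" where approx: "?E = (\<Union>n. {a n..b n})" "incseq b" "decseq a"
      "\<And>n. a n < b n" "\<And>n. l < a n" "\<And>n. b n < u" "a \<longlonglongrightarrow> l" "b \<longlonglongrightarrow> u"
    by (rule einterval_Icc_approximation[OF \<open>l < u\<close>]) (rule that)
  have aE: "a n \<in> ?E" and bE: "b n \<in> ?E" for n
    unfolding approx(1) using less_imp_le[OF approx(4)] by (auto intro!: exI[of _ n])
  \<comment> \<open>The limit hypothesis uses a punctured one-sided filter on \<open>ereal\<close>,
    so besides convergence the strict inequality \<open>l < a n\<close> is needed.\<close>
  have "filterlim (\<lambda>n. ereal (a n)) (at_right l) sequentially"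
    using approx(5,7) by (auto simp: filterlim_at less_imp_neq[THEN not_sym])
  from filterlim_compose[OF lim_l this] have Ha: "(\<lambda>n. h (a n) * G (a n)) \<longlonglongrightarrow> 0"
    by (simp add: hfq[OF aE])
  have "filterlim (\<lambda>n. ereal (b n)) (at_left u) sequentially"
    using approx(6,8) by (auto simp: filterlim_at less_imp_neq)
  from filterlim_compose[OF lim_u this] have Hb: "(\<lambda>n. h (b n) * G (b n)) \<longlonglongrightarrow> 0"
    by (simp add: hfq[OF bE])
  have "(\<lambda>n. LBINT z=a n..b n. X z) \<longlonglongrightarrow> 0"
    using tendsto_diff[OF Hb Ha] by (simp add: parts approx)
  \<comment> \<open>Since \<open>X\<close> is integrable, the integrals over the exhaustion converge
    to the full integral, which is therefore zero.\<close>
  moreover have "(\<lambda>n. LBINT z=a n..b n. X z) \<longlonglongrightarrow> (LBINT z=l..u. X z)"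
    by (rule interval_integral_Icc_approx_integrable[OF \<open>l < u\<close> approx X_int])
  ultimately have "(LBINT z=l..u. X z) = 0"
    by (rule LIMSEQ_unique[symmetric])
  then have "(LINT z|interval_distr l u (q lam). ?V z) =
      - (LINT z|interval_distr l u (q lam). ?U z)"
    using X_integral \<open>l < u\<close> by (simp add: interval_lebesgue_integral_le_eq)
  then show ?thesis
    using interchange_expectation unfolding r_def by simp
qed

end
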